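(* Let $K$ be a field, let $E$ be a row-finite directed graph, and let $I$ be any two-sided ideal of the Leavitt path algebra $L_K(E)$. Then $I$ is generated (as a two-sided ideal of $L_K(E)$) by elements of the form $v+\sum_{k=1}^m \lambda_k g^k$, where $v\in E^0$, $g$ is a cycle based at $v$ (possibly trivial), and $\lambda_1,\dots,\lambda_m\in K$. (Here $v$, $g$, $m$ and the $\lambda_k$ may vary from one generator to another.)
   Context: A directed graph $E=(E^0,E^1,r,s)$ consists of a set $E^0$ of vertices, a set $E^1$ of edges, and functions $r,s:E^1\to E^0$ (range and source). $E$ is row-finite if every vertex is the source of at most finitely many edges. Leavitt path algebra: $L_K(E)$ is the (associative, not necessarily unital) $K$-algebra generated by the set $E^0$ together with $\{e,e^*\mid e\in E^1\}$, subject to the relations: (1) $vv'=\delta_{v,v'}v$ for all $v,v'\in E^0$; (2) $s(e)e=e\,r(e)=e$ for all $e\in E^1$; (3) $r(e)e^*=e^*s(e)=e^*$ for all $e\in E^1$; (4) $e^*f=\delta_{e,f}r(e)$ for all $e,f\in E^1$; (5) $v=\sum_{\{e\in E^1\mid s(e)=v\}}ee^*$ for every $v\in E^0$ with $0<|s^{-1}(v)|<\infty$. Cycles: a path is a sequence of edges $\mu=e_1\cdots e_n$ with $r(e_i)=s(e_{i+1})$ for $i=1,\dots,n-1$; $s(\mu)=s(e_1)$, $r(\mu)=r(e_n)$. A path $\mu=e_1\cdots e_n$ of length $n\ge 1$ with $r(\mu)=s(\mu)=v$ and $s(e_i)\ne s(e_j)$ for all $i\neq j$ is a (non-trivial) cycle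 based at $v$. If there is no such cycle based at $v$, one lets $g=v$ and calls it the trivial cycle at $v$. Paths are regarded as elements of $L_K(E)$ (products of their edges), and $g^k$ denotes the $k$-th power in $L_K(E)$. *)

theory Defs
  imports "HOL-Library.Poly_Mapping" "Graph_Theory.Digraph" "Graph_Theory.Arc_Walk"
begin

section \<open>Algebras without unit\<close>

text \<open>
  Leavitt path algebras of graphs with infinitely many vertices have no unit, so neither the
  ring locale of HOL-Algebra nor its notion of ideal applies to them.
\<close>

record ('k, 'a) nu_algebra =
  na_carrier :: "'a set"
  na_zero :: "'a"
  na_add :: "'a \<Rightarrow> 'a \<Rightarrow> 'a"
  na_neg :: "'a \<Rightarrow> 'a"
  na_mult :: "'a \<Rightarrow> 'a \<Rightarrow> 'a"
  na_scale :: "'k \<Rightarrow> 'a \<Rightarrow> 'a"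

text \<open>
  Ideals are taken in the ring-theoretic sense: closure under scalars is not required. In an
  algebra with local units, such as a Leavitt path algebra, it is automatic.
\<close>

definition two_sided_ideal :: "('k, 'a) nu_algebra \<Rightarrow> 'a set \<Rightarrow> bool" where
  "two_sided_ideal A I \<longleftrightarrow>
     I \<subseteq> na_carrier A \<and> na_zero A \<in> I \<and>
     (\<forall>x\<in>I. \<forall>y\<in>I. na_add A x y \<in> I) \<and> (\<forall>x\<in>I. na_neg A x \<in> I) \<and>
     (\<forall>a\<in>na_carrier A. \<forall>x\<in>I. na_mult A a x \<in> I \<and> na_mult A x a \<in> I)"

definition ideal_generated :: "('k, 'a) nu_algebra \<Rightarrow> 'a set \<Rightarrow> 'a set" where
  "ideal_generated A X = \<Inter>{I. two_sided_ideal A I \<and> X \<subseteq> I}"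


section \<open>The free algebra on the vertices, edges and ghost edges\<close>

datatype ('v, 'e) lpa_gen = Vertex 'v | Edge 'e | Ghost 'e

text \<open>
  With concatenation as addition on exponents, \<^typ>\<open>'a list \<Rightarrow>\<^sub>0 'k\<close> is the free unital
  associative algebra on \<^typ>\<open>'a\<close>; its product is the convolution product of the library.
\<close>

instantiation list :: (type) monoid_add
begin

definition zero_list :: "'a list" where "zero_list = []"

definition plus_list :: "'a list \<Rightarrow> 'a list \<Rightarrow> 'a list" where "plus_list = append"

instance
  by standard (simp_all add: zero_list_def plus_list_def)

end

type_synonym ('v, 'e, 'k) free_alg = "('v, 'e) lpa_gen list \<Rightarrow>\<^sub>0 'k"

definition free_gen :: "('v, 'e) lpa_gen \<Rightarrow> ('v, 'e, 'k::field) free_alg" where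
  "free_gen x = Poly_Mapping.single [x] 1"

abbreviation vtx :: "'v \<Rightarrow> ('v, 'e, 'k::field) free_alg" where
  "vtx v \<equiv> free_gen (Vertex v)"

abbreviation edge :: "'e \<Rightarrow> ('v, 'e, 'k::field) free_alg" where
  "edge e \<equiv> free_gen (Edge e)"

abbreviation ghost :: "'e \<Rightarrow> ('v, 'e, 'k::field) free_alg" where
  "ghost e \<equiv> free_gen (Ghost e)"

definition free_scale :: "'k::field \<Rightarrow> ('v, 'e, 'k) free_alg \<Rightarrow> ('v, 'e, 'k) free_alg" where
  "free_scale c p = Poly_Mapping.map ((*) c) p"

definition lpa_gens :: "('v, 'e) pre_digraph \<Rightarrow> ('v, 'e) lpa_gen set" where
  "lpa_gens E = Vertex ` verts E \<union> Edge ` arcs E \<union> Ghost ` arcs E"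

text \<open>The free algebra without unit: the empty word does not occur.\<close>

definition free_carrier :: "('v, 'e) pre_digraph \<Rightarrow> ('v, 'e, 'k::field) free_alg set" where
  "free_carrier E = {p. Poly_Mapping.keys p \<subseteq> lists (lpa_gens E) - {[]}}"


section \<open>Leavitt path algebras\<close>

text \<open>
  The source of an edge is its \<^const>\<open>tail\<close> and its range is its \<^const>\<open>head\<close>. Each relation
  of the presentation is recorded as the difference of its two sides.
\<close>

inductive_set lpa_relations ::
  "('v, 'e) pre_digraph \<Rightarrow> ('v, 'e, 'k::field) free_alg set"
  for E :: "('v, 'e) pre_digraph"
where
  vertices: "\<lbrakk>v \<in> verts E; w \<in> verts E\<rbrakk> \<Longrightarrow>
    vtx v * vtx w - (if v = w then vtx v else 0) \<in> lpa_relations E"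
| source_edge: "e \<in> arcs E \<Longrightarrow> vtx (tail E e) * edge e - edge e \<in> lpa_relations E"
| edge_range: "e \<in> arcs E \<Longrightarrow> edge e * vtx (head E e) - edge e \<in> lpa_relations E"
| range_ghost: "e \<in> arcs E \<Longrightarrow> vtx (head E e) * ghost e - ghost e \<in> lpa_relations E"
| ghost_source: "e \<in> arcs E \<Longrightarrow> ghost e * vtx (tail E e) - ghost e \<in> lpa_relations E"
| CK1: "\<lbrakk>e \<in> arcs E; f \<in> arcs E\<rbrakk> \<Longrightarrow>
    ghost e * edge f - (if e = f then vtx (head E e) else 0) \<in> lpa_relations E"
| CK2: "\<lbrakk>v \<in> verts E; out_arcs E v \<noteq> {}; finite (out_arcs E v)\<rbrakk> \<Longrightarrow>
    vtx v - (\<Sum>e\<in>out_arcs E v. edge e * ghost e) \<in> lpa_relations E"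

text \<open>
  The algebra ideal of the free algebra without unit generated by the relations. Scalars have to
  be included here, since that algebra does not have local units.
\<close>

inductive_set lpa_kernel ::
  "('v, 'e) pre_digraph \<Rightarrow> ('v, 'e, 'k::field) free_alg set"
  for E :: "('v, 'e) pre_digraph"
where
  zero: "0 \<in> lpa_kernel E"
| relation: "p \<in> lpa_relations E \<Longrightarrow> p \<in> lpa_kernel E"
| add: "\<lbrakk>p \<in> lpa_kernel E; q \<in> lpa_kernel E\<rbrakk> \<Longrightarrow> p + q \<in> lpa_kernel E"
| scale: "p \<in> lpa_kernel E \<Longrightarrow> free_scale c p \<in> lpa_kernel E"
| mult_left: "\<lbrakk>a \<in> free_carrier E; p \<in> lpa_kernel E\<rbrakk> \<Longrightarrow> a * p \<in> lpa_kernel E"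
| mult_right: "\<lbrakk>a \<in> free_carrier E; p \<in> lpa_kernel E\<rbrakk> \<Longrightarrow> p * a \<in> lpa_kernel E"

definition lpa_class ::
  "('v, 'e) pre_digraph \<Rightarrow> ('v, 'e, 'k::field) free_alg \<Rightarrow> ('v, 'e, 'k) free_alg set" where
  "lpa_class E p = (\<lambda>j. p + j) ` lpa_kernel E"

definition leavitt_path_algebra ::
  "('v, 'e) pre_digraph \<Rightarrow> ('k::field, ('v, 'e, 'k) free_alg set) nu_algebra" where
  "leavitt_path_algebra E =
    \<lparr>na_carrier = lpa_class E ` free_carrier E,
     na_zero = lpa_class E 0,
     na_add = (\<lambda>X Y. \<Union>x\<in>X. \<Union>y\<in>Y. lpa_class E (x + y)),
     na_neg = (\<lambda>X. \<Union>x\<in>X. lpa_class E (- x)),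
     na_mult = (\<lambda>X Y. \<Union>x\<in>X. \<Union>y\<in>Y. lpa_class E (x * y)),
     na_scale = (\<lambda>c X. \<Union>x\<in>X. lpa_class E (free_scale c x))\<rparr>"


section \<open>Row-finiteness and cycles\<close>

definition row_finite :: "('v, 'e) pre_digraph \<Rightarrow> bool" where
  "row_finite E \<longleftrightarrow> (\<forall>v\<in>verts E. finite (out_arcs E v))"

definition cycle_based_at :: "('v, 'e) pre_digraph \<Rightarrow> 'v \<Rightarrow> 'e list \<Rightarrow> bool" where
  "cycle_based_at E v p \<longleftrightarrow>
     p \<noteq> [] \<and> pre_digraph.awalk E v p v \<and> distinct (map (tail E) p)"

text \<open>
  The elements denoted \<open>g\<close> for a vertex \<open>v\<close>: products of the edges of a cycle based at \<open>v\<close>, or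
  \<open>v\<close> itself (the trivial cycle) in case there is no cycle based at \<open>v\<close>. They are formed in the
  free algebra; \<^const>\<open>lpa_class\<close>, which preserves sums, products and scalar multiples by the
  lemmas below, carries expressions in them to the Leavitt path algebra.
\<close>

definition cycle_element ::
  "('v, 'e) pre_digraph \<Rightarrow> 'v \<Rightarrow> ('v, 'e, 'k::field) free_alg \<Rightarrow> bool" where
  "cycle_element E v g \<longleftrightarrow>
     (\<exists>p. cycle_based_at E v p \<and> g = prod_list (map edge p)) \<or>
     ((\<nexists>p. cycle_based_at E v p) \<and> g = vtx v)"


section \<open>The class map is a homomorphism onto the Leavitt path algebra\<close>

lemma free_scale_conv_mult: "free_scale c p = Poly_Mapping.single [] c * p"
  unfolding free_scale_def mult_map_scale_conv_mult zero_list_def ..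

lemma free_carrier_zero: "0 \<in> free_carrier E"
  by (simp add: free_carrier_def)

lemma free_carrier_add: "\<lbrakk>p \<in> free_carrier E; q \<in> free_carrier E\<rbrakk> \<Longrightarrow> p + q \<in> free_carrier E"
  using keys_add[of p q] unfolding free_carrier_def by blast

lemma free_carrier_uminus: "p \<in> free_carrier E \<Longrightarrow> - p \<in> free_carrier E"
  by (simp add: free_carrier_def Poly_Mapping.keys_def uminus_poly_mapping.rep_eq)

lemma free_carrier_diff: "\<lbrakk>p \<in> free_carrier E; q \<in> free_carrier E\<rbrakk> \<Longrightarrow> p - q \<in> free_carrier E"
  using free_carrier_add[OF _ free_carrier_uminus, of p E q] by simp

lemma free_carrier_mult: "\<lbrakk>p \<in> free_carrier E; q \<in> free_carrier E\<rbrakk> \<Longrightarrow> p * q \<in> free_carrier E"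
  using keys_mult[of p q] unfolding free_carrier_def plus_list_def by fastforce

lemma free_carrier_scale: "p \<in> free_carrier E \<Longrightarrow> free_scale c p \<in> free_carrier E"
  by (auto simp: free_carrier_def free_scale_def in_keys_iff map.rep_eq when_def split: if_splits)

lemma free_carrier_sum: "(\<And>x. x \<in> A \<Longrightarrow> f x \<in> free_carrier E) \<Longrightarrow> sum f A \<in> free_carrier E"
  by (induction A rule: infinite_finite_induct) (auto intro: free_carrier_zero free_carrier_add)

lemma free_carrier_gen: "x \<in> lpa_gens E \<Longrightarrow> free_gen x \<in> free_carrier E"
  by (simp add: free_carrier_def free_gen_def)

lemma lpa_relations_carrier:
  assumes "wf_digraph E" "p \<in> lpa_relations E"
  shows "p \<in> free_carrier E"
proof -
  have gens: "vtx v \<in> free_carrier E" if "v \<in> verts E" for v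
    using that by (auto intro: free_carrier_gen simp: lpa_gens_def)
  have gens': "edge e \<in> free_carrier E" "ghost e \<in> free_carrier E"
    "vtx (tail E e) \<in> free_carrier E" "vtx (head E e) \<in> free_carrier E" if "e \<in> arcs E" for e
    using that wf_digraph.wellformed[OF assms(1)]
    by (auto intro: free_carrier_gen simp: lpa_gens_def)
  show ?thesis
    using assms(2)
    by cases (auto intro!: free_carrier_diff free_carrier_mult free_carrier_sum
        free_carrier_zero gens gens' simp: out_arcs_def)
qed

lemma lpa_kernel_carrier:
  assumes "wf_digraph E" "p \<in> lpa_kernel E"
  shows "p \<in> free_carrier E"
  using assms(2)
  by induction (auto intro: free_carrier_zero free_carrier_add free_carrier_scale
      free_carrier_mult lpa_relations_carrier[OF assms(1)])

lemma lpa_kernel_uminus: "p \<in> lpa_kernel E \<Longrightarrow> - p \<in> lpa_kernel E"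
  using lpa_kernel.scale[of p E "- 1"]
  by (simp add: free_scale_conv_mult single_uminus flip: zero_list_def)

lemma lpa_kernel_diff: "\<lbrakk>p \<in> lpa_kernel E; q \<in> lpa_kernel E\<rbrakk> \<Longrightarrow> p - q \<in> lpa_kernel E"
  using lpa_kernel.add[OF _ lpa_kernel_uminus, of p E q] by simp

lemma lpa_class_iff: "q \<in> lpa_class E p \<longleftrightarrow> q - p \<in> lpa_kernel E"
  by (force simp: lpa_class_def image_iff)

lemma lpa_class_self: "p \<in> lpa_class E p"
  by (simp add: lpa_class_iff lpa_kernel.zero)

lemma lpa_class_eq_iff: "lpa_class E p = lpa_class E q \<longleftrightarrow> p - q \<in> lpa_kernel E"
proof
  assume *: "p - q \<in> lpa_kernel E"
  show "lpa_class E p = lpa_class E q"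
  proof (intro set_eqI)
    fix x
    show "x \<in> lpa_class E p \<longleftrightarrow> x \<in> lpa_class E q"
      using lpa_kernel.add[OF _ *, of "x - p"] lpa_kernel_diff[OF _ *, of "x - q"]
      by (auto simp: lpa_class_iff)
  qed
qed (metis lpa_class_iff lpa_class_self)

lemma UN_eq_const: "\<lbrakk>a \<in> A; \<And>x. x \<in> A \<Longrightarrow> f x = c\<rbrakk> \<Longrightarrow> (\<Union>x\<in>A. f x) = c"
  by auto

lemma lpa_add_class:
  "na_add (leavitt_path_algebra E) (lpa_class E p) (lpa_class E q) = lpa_class E (p + q)"
proof -
  have "lpa_class E (x + y) = lpa_class E (p + q)"
    if "x \<in> lpa_class E p" "y \<in> lpa_class E q" for x y
    using lpa_kernel.add[of "x - p" E "y - q"] that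
    by (simp add: lpa_class_iff lpa_class_eq_iff algebra_simps)
  then have "(\<Union>x\<in>lpa_class E p. \<Union>y\<in>lpa_class E q. lpa_class E (x + y)) = lpa_class E (p + q)"
    by (intro UN_eq_const[OF lpa_class_self]) blast+
  then show ?thesis by (simp add: leavitt_path_algebra_def)
qed

lemma lpa_neg_class:
  "na_neg (leavitt_path_algebra E) (lpa_class E p) = lpa_class E (- p)"
proof -
  have "lpa_class E (- x) = lpa_class E (- p)" if "x \<in> lpa_class E p" for x
    using lpa_kernel_uminus[of "x - p" E] that
    by (simp add: lpa_class_iff lpa_class_eq_iff algebra_simps)
  then have "(\<Union>x\<in>lpa_class E p. lpa_class E (- x)) = lpa_class E (- p)"
    by (intro UN_eq_const[OF lpa_class_self]) blast+
  then show ?thesis by (simp add: leavitt_path_algebra_def)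
qed

lemma lpa_scale_class:
  "na_scale (leavitt_path_algebra E) c (lpa_class E p) = lpa_class E (free_scale c p)"
proof -
  have "lpa_class E (free_scale c x) = lpa_class E (free_scale c p)" if "x \<in> lpa_class E p" for x
    using lpa_kernel.scale[of "x - p" E c] that
    by (simp add: lpa_class_iff lpa_class_eq_iff free_scale_conv_mult algebra_simps)
  then have "(\<Union>x\<in>lpa_class E p. lpa_class E (free_scale c x)) = lpa_class E (free_scale c p)"
    by (intro UN_eq_const[OF lpa_class_self]) blast+
  then show ?thesis by (simp add: leavitt_path_algebra_def)
qed

lemma lpa_mult_class:
  assumes "wf_digraph E" "p \<in> free_carrier E" "q \<in> free_carrier E"
  shows "na_mult (leavitt_path_algebra E) (lpa_class E p) (lpa_class E q) = lpa_class E (p * q)"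
proof -
  have "lpa_class E (x * y) = lpa_class E (p * q)"
    if "x \<in> lpa_class E p" "y \<in> lpa_class E q" for x y
  proof -
    have "x = p + (x - p)" by simp
    with that assms have x: "x \<in> free_carrier E"
      by (metis free_carrier_add lpa_class_iff lpa_kernel_carrier)
    have "x * y - p * q = x * (y - q) + (x - p) * q"
      by (simp add: algebra_simps)
    also have "\<dots> \<in> lpa_kernel E"
      using that x assms
      by (auto simp: lpa_class_iff intro: lpa_kernel.add lpa_kernel.mult_left lpa_kernel.mult_right)
    finally show ?thesis by (simp add: lpa_class_eq_iff)
  qed
  then have "(\<Union>x\<in>lpa_class E p. \<Union>y\<in>lpa_class E q. lpa_class E (x * y)) = lpa_class E (p * q)"
    by (intro UN_eq_const[OF lpa_class_self]) blast+
  then show ?thesis by (simp add: leavitt_path_algebra_def)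
qed

end

theory Submission
  imports Defs
begin

text \<open>
  Let \<open>J\<close> be any ideal containing the generators of the stated form that lie in \<open>I\<close>, and suppose
  \<open>I\<close> is not contained in \<open>J\<close>. By row-finiteness an element of \<open>I\<close> outside \<open>J\<close> stays outside \<open>J\<close> after
  right multiplication by a suitable long path, which removes the ghost edges. Among the linear
  combinations of real paths in \<open>I\<close> but not in \<open>J\<close> take one with the fewest terms. Its shortest path
  is a prefix of all others, so one may assume that it is \<open>k v + \<Sum> k\<^sub>i \<gamma>\<^sub>i\<close> with closed paths \<open>\<gamma>\<^sub>i\<close> at
  \<open>v\<close>. Minimality forces all \<open>\<gamma>\<^sub>i\<close> to start with the same edge, to stay minimal when rotated by it, and
  to use no other edge at \<open>v\<close>. Hence no vertex has two outgoing edges on the \<open>\<gamma>\<^sub>i\<close>, so they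
  are all powers of one cycle, and the element is a scalar multiple of a generator.
\<close>

section \<open>Words modulo the defining relations\<close>

text \<open>The leading vertex records the source and keeps the word of a trivial path nonempty.\<close>

definition path_word :: "'v \<Rightarrow> 'e list \<Rightarrow> ('v, 'e) lpa_gen list" where
  "path_word u p = Vertex u # map Edge p"

lemma path_word_simps [simp]:
  "path_word u [] = [Vertex u]"
  "path_word u p @ map Edge q = path_word u (p @ q)"
  by (simp_all add: path_word_def)

lemma path_word_eq_iff [simp]: "path_word u p = path_word u q \<longleftrightarrow> p = q"
  by (auto simp: path_word_def inj_map_eq_map inj_def)

lemma single_times_single_list [simp]:
  "Poly_Mapping.single v a * Poly_Mapping.single w b
     = Poly_Mapping.single (v @ w) (a * b :: 'k::field)"
  by (simp add: mult_single plus_list_def)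

lemma single_Nil_one: "Poly_Mapping.single [] (1 :: 'k::field) = 1"
  using single_one zero_list_def by metis

lemma poly_mapping_eq_sum_single:
  "p = (\<Sum>w\<in>Poly_Mapping.keys p. Poly_Mapping.single w (Poly_Mapping.lookup p w))"
  by (intro poly_mapping_eqI)
     (auto simp: lookup_sum lookup_single when_def sum.delta in_keys_iff)

lemma free_scale_single:
  "free_scale a (Poly_Mapping.single w b) = Poly_Mapping.single w (a * b)"
  by (simp add: free_scale_conv_mult)

lemma single_Nil_commute: "Poly_Mapping.single [] (k::'k::field) * p = p * Poly_Mapping.single [] k"
  (is "?L = ?R")
proof -
  have "?L = (\<Sum>w\<in>Poly_Mapping.keys p.
      Poly_Mapping.single [] k * Poly_Mapping.single w (Poly_Mapping.lookup p w))"
    by (subst (1) poly_mapping_eq_sum_single[of p]) (simp only: sum_distrib_left)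
  also have "\<dots> = (\<Sum>w\<in>Poly_Mapping.keys p.
      Poly_Mapping.single w (Poly_Mapping.lookup p w) * Poly_Mapping.single [] k)"
    by (simp add: mult.commute)
  also have "\<dots> = ?R"
    by (subst (3) poly_mapping_eq_sum_single[of p]) (simp only: sum_distrib_right)
  finally show ?thesis .
qed

definition path_sum :: "'v \<Rightarrow> 'e list set \<Rightarrow> ('e list \<Rightarrow> 'k) \<Rightarrow> ('v, 'e, 'k::field) free_alg" where
  "path_sum u A c = (\<Sum>p\<in>A. Poly_Mapping.single (path_word u p) (c p))"

lemma bij_betw_append:
  "bij_betw (\<lambda>r. p @ r) {r. p @ r \<in> A} {q \<in> A. take (length p) q = p}"
  by (auto simp: bij_betw_def inj_on_def image_iff) (metis append_take_drop_id)

context wf_digraph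
begin

abbreviation gens where "gens \<equiv> lpa_gens G"

lemma gens_simps [simp]:
  "Vertex v \<in> gens \<longleftrightarrow> v \<in> verts G" "Edge e \<in> gens \<longleftrightarrow> e \<in> arcs G" "Ghost e \<in> gens \<longleftrightarrow> e \<in> arcs G"
  by (auto simp: lpa_gens_def)

abbreviation cl :: "('a, 'b, 'k::field) free_alg \<Rightarrow> ('a, 'b, 'k) free_alg set" where
  "cl \<equiv> lpa_class G"

lemma kernel_single_left:
  assumes "p \<in> lpa_kernel G" "w \<in> lists gens"
  shows "Poly_Mapping.single w (k::'k::field) * p \<in> lpa_kernel G"
proof (cases "w = []")
  case True
  then show ?thesis using lpa_kernel.scale[OF assms(1), of k] by (simp add: free_scale_conv_mult)
next
  case False
  then show ?thesis using assms by (intro lpa_kernel.mult_left) (auto simp: free_carrier_def)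
qed

lemma kernel_single_right:
  assumes "p \<in> lpa_kernel G" "w \<in> lists gens"
  shows "p * Poly_Mapping.single w (k::'k::field) \<in> lpa_kernel G"
proof (cases "w = []")
  case True
  then show ?thesis using lpa_kernel.scale[OF assms(1), of k]
    by (simp add: free_scale_conv_mult single_Nil_commute)
next
  case False
  then show ?thesis using assms by (intro lpa_kernel.mult_right) (auto simp: free_carrier_def)
qed

lemma cl_add: "cl p = cl p' \<Longrightarrow> cl q = cl q' \<Longrightarrow> cl (p + q) = cl (p' + q')"
  using lpa_kernel.add[of "p - p'" G "q - q'"] by (simp add: lpa_class_eq_iff algebra_simps)

lemma cl_sum: "(\<And>a. a \<in> A \<Longrightarrow> cl (f a) = cl (g a)) \<Longrightarrow> cl (sum f A) = cl (sum g A)"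
proof (induction A rule: infinite_finite_induct)
  case (insert a A)
  then show ?case using cl_add[of "f a" "g a" "sum f A" "sum g A"] by simp
qed simp_all

lemma cl_single_left:
  "cl p = cl q \<Longrightarrow> w \<in> lists gens \<Longrightarrow>
   cl (Poly_Mapping.single w k * p) = cl (Poly_Mapping.single w k * q)"
  using kernel_single_left[of "p - q" w k] by (simp add: lpa_class_eq_iff algebra_simps)

lemma cl_single_right:
  "cl p = cl q \<Longrightarrow> w \<in> lists gens \<Longrightarrow>
   cl (p * Poly_Mapping.single w k) = cl (q * Poly_Mapping.single w k)"
  using kernel_single_right[of "p - q" w k] by (simp add: lpa_class_eq_iff algebra_simps)

abbreviation clw :: "('a, 'b) lpa_gen list \<Rightarrow> 'k::field \<Rightarrow> ('a, 'b, 'k) free_alg set" where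
  "clw w k \<equiv> cl (Poly_Mapping.single w k)"

lemma clw_context:
  assumes "clw x (1::'k::field) = clw y 1" "a \<in> lists gens" "b \<in> lists gens"
  shows "clw (a @ x @ b) (k::'k) = clw (a @ y @ b) k"
  using cl_single_right[OF cl_single_left[OF assms(1,2), of k] assms(3), of 1] by simp

lemma clw_context_zero:
  assumes "clw x (1::'k::field) = cl 0" "a \<in> lists gens" "b \<in> lists gens"
  shows "clw (a @ x @ b) (k::'k) = cl 0"
  using cl_single_right[OF cl_single_left[OF assms(1,2), of k] assms(3), of 1] by simp

lemma clw_vertex_vertex:
  assumes "v \<in> verts G" "w \<in> verts G"
  shows "clw [Vertex v, Vertex w] (1::'k::field) = (if v = w then clw [Vertex v] 1 else cl 0)"
  using lpa_kernel.relation[OF lpa_relations.vertices[where ?'k = 'k, OF assms]]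
  by (auto simp: lpa_class_eq_iff free_gen_def split: if_splits)

lemma clw_edge:
  assumes "e \<in> arcs G"
  shows "clw [Vertex (tail G e), Edge e] (1::'k::field) = clw [Edge e] 1"
    "clw [Edge e, Vertex (head G e)] (1::'k) = clw [Edge e] 1"
    "clw [Vertex (head G e), Ghost e] (1::'k) = clw [Ghost e] 1"
    "clw [Ghost e, Vertex (tail G e)] (1::'k) = clw [Ghost e] 1"
  using lpa_kernel.relation[OF lpa_relations.source_edge[where ?'k = 'k, OF assms]]
    lpa_kernel.relation[OF lpa_relations.edge_range[where ?'k = 'k, OF assms]]
    lpa_kernel.relation[OF lpa_relations.range_ghost[where ?'k = 'k, OF assms]]
    lpa_kernel.relation[OF lpa_relations.ghost_source[where ?'k = 'k, OF assms]]
  by (simp_all add: lpa_class_eq_iff free_gen_def)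

lemma clw_ghost_edge:
  assumes "e \<in> arcs G" "f \<in> arcs G"
  shows "clw [Ghost e, Edge f] (1::'k::field) = (if e = f then clw [Vertex (head G e)] 1 else cl 0)"
  using lpa_kernel.relation[OF lpa_relations.CK1[where ?'k = 'k, OF assms]]
  by (auto simp: lpa_class_eq_iff free_gen_def split: if_splits)

lemma clw_vertex:
  assumes "v \<in> verts G" "out_arcs G v \<noteq> {}" "finite (out_arcs G v)"
  shows "clw [Vertex v] (1::'k::field)
    = cl (\<Sum>e\<in>out_arcs G v. Poly_Mapping.single [Edge e, Ghost e] 1)"
  using lpa_kernel.relation[OF lpa_relations.CK2[where ?'k = 'k, OF assms]]
  by (simp add: lpa_class_eq_iff free_gen_def)

fun gen_source :: "('a, 'b) lpa_gen \<Rightarrow> 'a" where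
  "gen_source (Vertex v) = v"
| "gen_source (Edge e) = tail G e"
| "gen_source (Ghost e) = head G e"

fun gen_range :: "('a, 'b) lpa_gen \<Rightarrow> 'a" where
  "gen_range (Vertex v) = v"
| "gen_range (Edge e) = head G e"
| "gen_range (Ghost e) = tail G e"

lemma gen_source_in_verts: "x \<in> gens \<Longrightarrow> gen_source x \<in> verts G"
  by (cases x) auto

lemma gen_range_in_verts: "x \<in> gens \<Longrightarrow> gen_range x \<in> verts G"
  by (cases x) auto

lemma clw_gen_source: "x \<in> gens \<Longrightarrow> clw [Vertex (gen_source x), x] (1::'k::field) = clw [x] 1"
  by (cases x) (auto simp: clw_edge clw_vertex_vertex)

lemma clw_gen_range: "x \<in> gens \<Longrightarrow> clw [x, Vertex (gen_range x)] (1::'k::field) = clw [x] 1"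
  by (cases x) (auto simp: clw_edge clw_vertex_vertex)

lemma clw_Vertex_Cons:
  assumes "w \<in> lists gens" "w \<noteq> []" "v \<in> verts G"
  shows "clw (Vertex v # w) (k::'k::field) = (if v = gen_source (hd w) then clw w k else cl 0)"
proof -
  obtain x y where w: "w = x # y" using assms(2) by (cases w) auto
  have x: "x \<in> gens" "gen_source x \<in> verts G" "y \<in> lists gens"
    using assms(1) w gen_source_in_verts by auto
  have *: "clw (Vertex (gen_source x) # w) k = clw w k"
    using clw_context[OF clw_gen_source[OF x(1)], of "[]" y k] x w by simp
  show ?thesis
  proof (cases "v = gen_source x")
    case False
    have "clw (Vertex v # w) k = clw (Vertex v # Vertex (gen_source x) # w) k"
      using clw_context[OF clw_gen_source[OF x(1)], of "[Vertex v]" y k] x w assms by simp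
    also have "\<dots> = cl 0"
      using clw_context_zero[of "[Vertex v, Vertex (gen_source x)]" "[]" w k] assms x False
      by (simp add: clw_vertex_vertex)
    finally show ?thesis using w False by simp
  qed (use * w in simp)
qed

lemma clw_snoc_Vertex:
  assumes "w \<in> lists gens" "w \<noteq> []" "v \<in> verts G"
  shows "clw (w @ [Vertex v]) (k::'k::field) = (if v = gen_range (last w) then clw w k else cl 0)"
proof -
  obtain x y where w: "w = y @ [x]" using assms(2) by (cases w rule: rev_cases) auto
  have x: "x \<in> gens" "gen_range x \<in> verts G" "y \<in> lists gens"
    using assms(1) w gen_range_in_verts by auto
  have *: "clw (w @ [Vertex (gen_range x)]) k = clw w k"
    using clw_context[OF clw_gen_range[OF x(1)], of y "[]" k] x w by simp
  show ?thesis
  proof (cases "v = gen_range x")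
    case False
    have "clw (w @ [Vertex v]) k = clw (w @ [Vertex (gen_range x), Vertex v]) k"
      using clw_context[OF clw_gen_range[OF x(1)], of y "[Vertex v]" k] x w assms by simp
    also have "\<dots> = cl 0"
      using clw_context_zero[of "[Vertex (gen_range x), Vertex v]" w "[]" k] assms x False
      by (simp add: clw_vertex_vertex)
    finally show ?thesis using w False by simp
  qed (use * w in simp)
qed

lemma local_unit_left:
  assumes "p \<in> free_carrier G"
  obtains F where "finite F" "F \<subseteq> verts G"
    "cl (free_scale (k::'k::field) p) = cl (\<Sum>v\<in>F. Poly_Mapping.single [Vertex v] k * p)"
proof -
  define K where "K = Poly_Mapping.keys p"
  define c where "c = Poly_Mapping.lookup p"
  define F where "F = (gen_source \<circ> hd) ` K"
  have p: "p = (\<Sum>w\<in>K. Poly_Mapping.single w (c w))"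
    unfolding K_def c_def by (rule poly_mapping_eq_sum_single)
  have "finite K" by (simp add: K_def)
  have K: "w \<in> lists gens" "w \<noteq> []" if "w \<in> K" for w
    using that assms by (auto simp: K_def free_carrier_def)
  have "finite F" using \<open>finite K\<close> by (simp add: F_def)
  have F: "F \<subseteq> verts G"
    using K unfolding F_def by (auto intro!: gen_source_in_verts) (metis hd_in_set in_lists_conv_set)
  have "(\<Sum>v\<in>F. Poly_Mapping.single [Vertex v] k * p)
      = (\<Sum>v\<in>F. \<Sum>w\<in>K. Poly_Mapping.single (Vertex v # w) (k * c w))"
    by (subst p) (simp add: sum_distrib_left)
  also have "\<dots> = (\<Sum>w\<in>K. \<Sum>v\<in>F. Poly_Mapping.single (Vertex v # w) (k * c w))"
    by (rule sum.swap)
  finally have 1: "(\<Sum>v\<in>F. Poly_Mapping.single [Vertex v] k * p) = \<dots>" .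
  have "cl (\<Sum>v\<in>F. Poly_Mapping.single (Vertex v # w) (k * c w))
      = cl (Poly_Mapping.single w (k * c w))" if "w \<in> K" for w
  proof -
    have "cl (\<Sum>v\<in>F. Poly_Mapping.single (Vertex v # w) (k * c w))
        = cl (\<Sum>v\<in>F. if v = gen_source (hd w) then Poly_Mapping.single w (k * c w) else 0)"
      using F K[OF that] by (intro cl_sum) (simp add: clw_Vertex_Cons subset_iff)
    also have "(\<Sum>v\<in>F. if v = gen_source (hd w) then Poly_Mapping.single w (k * c w) else 0)
        = Poly_Mapping.single w (k * c w)"
      using that \<open>finite F\<close> by (subst sum.delta) (auto simp: F_def)
    finally show ?thesis .
  qed
  then have 2: "cl (\<Sum>w\<in>K. \<Sum>v\<in>F. Poly_Mapping.single (Vertex v # w) (k * c w))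
      = cl (\<Sum>w\<in>K. Poly_Mapping.single w (k * c w))"
    by (rule cl_sum)
  have 3: "(\<Sum>w\<in>K. Poly_Mapping.single w (k * c w)) = free_scale k p"
    by (subst p)
       (simp add: free_scale_conv_mult sum_distrib_left)
  have "cl (free_scale k p) = cl (\<Sum>v\<in>F. Poly_Mapping.single [Vertex v] k * p)"
    using 1 2 3 by simp
  with \<open>finite F\<close> F show ?thesis by (rule that)
qed

lemma local_unit_right:
  assumes "p \<in> free_carrier G"
  obtains F where "finite F" "F \<subseteq> verts G"
    "cl p = cl (\<Sum>v\<in>F. p * Poly_Mapping.single [Vertex v] (1::'k::field))"
proof -
  define K where "K = Poly_Mapping.keys p"
  define c where "c = Poly_Mapping.lookup p"
  define F where "F = (gen_range \<circ> last) ` K"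
  have p: "p = (\<Sum>w\<in>K. Poly_Mapping.single w (c w))"
    unfolding K_def c_def by (rule poly_mapping_eq_sum_single)
  have "finite K" by (simp add: K_def)
  have K: "w \<in> lists gens" "w \<noteq> []" if "w \<in> K" for w
    using that assms by (auto simp: K_def free_carrier_def)
  have "finite F" using \<open>finite K\<close> by (simp add: F_def)
  have F: "F \<subseteq> verts G"
    using K unfolding F_def by (auto intro!: gen_range_in_verts) (metis last_in_set in_lists_conv_set)
  have "(\<Sum>v\<in>F. p * Poly_Mapping.single [Vertex v] 1)
      = (\<Sum>v\<in>F. \<Sum>w\<in>K. Poly_Mapping.single (w @ [Vertex v]) (c w))"
    by (subst p) (simp add: sum_distrib_right)
  also have "\<dots> = (\<Sum>w\<in>K. \<Sum>v\<in>F. Poly_Mapping.single (w @ [Vertex v]) (c w))"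
    by (rule sum.swap)
  finally have 1: "(\<Sum>v\<in>F. p * Poly_Mapping.single [Vertex v] 1) = \<dots>" .
  have "cl (\<Sum>v\<in>F. Poly_Mapping.single (w @ [Vertex v]) (c w))
      = cl (Poly_Mapping.single w (c w))" if "w \<in> K" for w
  proof -
    have "cl (\<Sum>v\<in>F. Poly_Mapping.single (w @ [Vertex v]) (c w))
        = cl (\<Sum>v\<in>F. if v = gen_range (last w) then Poly_Mapping.single w (c w) else 0)"
      using F K[OF that] by (intro cl_sum) (simp add: clw_snoc_Vertex subset_iff)
    also have "(\<Sum>v\<in>F. if v = gen_range (last w) then Poly_Mapping.single w (c w) else 0)
        = Poly_Mapping.single w (c w)"
      using that \<open>finite F\<close> by (subst sum.delta) (auto simp: F_def)
    finally show ?thesis .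
  qed
  then have 2: "cl (\<Sum>w\<in>K. \<Sum>v\<in>F. Poly_Mapping.single (w @ [Vertex v]) (c w))
      = cl (\<Sum>w\<in>K. Poly_Mapping.single w (c w))"
    by (rule cl_sum)
  have "cl p = cl (\<Sum>v\<in>F. p * Poly_Mapping.single [Vertex v] 1)"
    using 1 2 p by simp
  with \<open>finite F\<close> F show ?thesis by (rule that)
qed

lemma awalk_arcs_in: "awalk u p v \<Longrightarrow> e \<in> set p \<Longrightarrow> e \<in> arcs G"
  unfolding awalk_def by blast

lemma path_word_in_lists: "awalk u p v \<Longrightarrow> path_word u p \<in> lists gens"
  by (simp add: path_word_def in_lists_conv_set lpa_gens_def awalk_arcs_in image_iff awalk_hd_in_verts)

lemma map_Edge_in_lists: "awalk u p v \<Longrightarrow> map Edge p \<in> lists gens"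
  by (simp add: in_lists_conv_set lpa_gens_def awalk_arcs_in image_iff)

lemma map_Ghost_in_lists: "awalk u p v \<Longrightarrow> map Ghost (rev p) \<in> lists gens"
  by (simp add: in_lists_conv_set lpa_gens_def awalk_arcs_in image_iff)

lemma gen_range_path_word: "awalk u p v \<Longrightarrow> gen_range (last (path_word u p)) = v"
  by (cases p rule: rev_cases) (auto simp: path_word_def awalk_simps)

lemma clw_path_append:
  assumes "awalk u p v" "awalk v q w"
  shows "clw (path_word u p @ path_word v q) (k::'k::field) = clw (path_word u (p @ q)) k"
proof -
  have v: "v \<in> verts G" using assms(2) by auto
  have "clw (path_word u p @ [Vertex v]) (1::'k) = clw (path_word u p) 1"
    using clw_snoc_Vertex[OF path_word_in_lists[OF assms(1)] _ v, of 1] gen_range_path_word[OF assms(1)]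
    by (simp add: path_word_def)
  from clw_context[OF this, of "[]" "map Edge q" k] map_Edge_in_lists[OF assms(2)]
  show ?thesis by (simp add: path_word_def)
qed

lemma clw_path_snoc_Vertex:
  assumes "awalk u p v"
  shows "clw (path_word u p @ [Vertex v]) (k::'k::field) = clw (path_word u p) k"
  using clw_path_append[OF assms, of "[]" v k] assms by (auto simp: awalk_simps)

lemma clw_Vertex_path:
  assumes "awalk u p v" "w \<in> verts G"
  shows "clw (Vertex w # path_word u p) (k::'k::field)
    = (if w = u then clw (path_word u p) k else cl 0)"
  using clw_Vertex_Cons[OF path_word_in_lists[OF assms(1)] _ assms(2), of k]
  by (simp add: path_word_def)

lemma clw_map_Edge:
  assumes "awalk u p v" "p \<noteq> []"
  shows "clw (map Edge p) (k::'k::field) = clw (path_word u p) k"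
proof -
  have "u \<in> verts G" "gen_source (hd (map Edge p)) = u"
    using assms by (cases p; auto simp: awalk_simps)+
  then show ?thesis
    using clw_Vertex_Cons[OF map_Edge_in_lists[OF assms(1)], of u k] assms
    by (simp add: path_word_def)
qed

lemma clw_gen_path_cases:
  assumes "x \<in> gens" "awalk u p v" "p = [] \<Longrightarrow> out_arcs G v = {}"
  shows "(\<forall>k::'k::field. clw (x # path_word u p) k = cl 0) \<or>
    (\<exists>u' p'. awalk u' p' v \<and> length p \<le> Suc (length p') \<and>
      (\<forall>k::'k. clw (x # path_word u p) k = clw (path_word u' p') k))"
proof (cases "gen_range x = u")
  case False
  have "u \<in> verts G" using assms by auto
  then have "clw ([x] @ [Vertex u]) (1::'k) = cl 0"
    using False clw_snoc_Vertex[of "[x]" u 1] assms(1) by simp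
  from clw_context_zero[OF this, of "[]" "map Edge p"] map_Edge_in_lists[OF assms(2)]
  show ?thesis by (simp add: path_word_def)
next
  case True
  have "clw ([x] @ [Vertex u]) (1::'k) = clw [x] 1"
    using True clw_gen_range[of x] assms(1) by simp
  from clw_context[OF this, of "[]" "map Edge p"] map_Edge_in_lists[OF assms(2)]
  have *: "clw (x # path_word u p) k = clw (x # map Edge p) k" for k :: 'k
    by (simp add: path_word_def)
  show ?thesis
  proof (cases x)
    case (Vertex w)
    then show ?thesis
      using assms(2) True clw_Vertex_path[where ?'k = 'k, OF assms(2), of u]
      by (intro disjI2 exI[of _ u] exI[of _ p]) (simp add: awalk_hd_in_verts)
  next
    case (Edge e)
    then have w: "awalk (tail G e) (e # p) v"
      using assms(1,2) True by (auto simp: awalk_simps)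
    show ?thesis
      using * clw_map_Edge[where ?'k = 'k, OF w] w unfolding Edge
      by (intro disjI2 exI[of _ "tail G e"] exI[of _ "e # p"]) simp
  next
    case (Ghost e)
    then have e: "e \<in> arcs G" "u = tail G e" using True assms(1) by auto
    have "p \<noteq> []" using assms(2,3) e by (auto simp: awalk_simps out_arcs_def)
    then obtain f q where p: "p = f # q" by (cases p) auto
    have f: "f \<in> arcs G" and q: "awalk (head G f) q v"
      using assms(2) by (auto simp: awalk_simps p)
    note ef = clw_ghost_edge[OF e(1) f, where ?'k = 'k]
    show ?thesis
    proof (cases "e = f")
      case True
      then have "clw (Ghost e # map Edge p) k = clw (path_word (head G f) q) k" for k :: 'k
        using clw_context[of "[Ghost e, Edge f]" "[Vertex (head G e)]" "[]" "map Edge q" k] ef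
          map_Edge_in_lists[OF q] p by (simp add: path_word_def)
      then show ?thesis using * q p unfolding Ghost
        by (intro disjI2 exI[of _ "head G f"] exI[of _ q]) simp
    next
      case False
      then have "clw (Ghost e # map Edge p) k = cl 0" for k :: 'k
        using clw_context_zero[of "[Ghost e, Edge f]" "[]" "map Edge q" k] ef
          map_Edge_in_lists[OF q] p by (simp add: path_word_def)
      then show ?thesis using * Ghost by simp
    qed
  qed
qed

text \<open>
  Right multiplication by a path that is long, or that ends in a sink, uses up all ghost edges.
  This replaces the normal form of the elements of the algebra.
\<close>

lemma clw_word_path_cases:
  assumes "w \<in> lists gens" "awalk u p v" "length w \<le> length p \<or> out_arcs G v = {}"
  shows "(\<forall>k::'k::field. clw (w @ path_word u p) k = cl 0) \<or>
    (\<exists>u' p'. awalk u' p' v \<and> (\<forall>k::'k. clw (w @ path_word u p) k = clw (path_word u' p') k))"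
  using assms
proof (induction w arbitrary: u p rule: rev_induct)
  case Nil
  then show ?case by auto
next
  case (snoc x w)
  have w: "w \<in> lists gens" and x: "x \<in> gens" using snoc.prems(1) by auto
  have "p = [] \<Longrightarrow> out_arcs G v = {}" using snoc.prems(3) by auto
  from clw_gen_path_cases[where ?'k = 'k, OF x snoc.prems(2) this]
  consider "\<forall>k::'k. clw (x # path_word u p) k = cl 0"
    | u' p' where "awalk u' p' v" "length p \<le> Suc (length p')"
      "\<forall>k::'k. clw (x # path_word u p) k = clw (path_word u' p') k"
    by (cases "p = []") blast+
  then show ?case
  proof cases
    case 1
    then show ?thesis
      using clw_context_zero[where ?'k = 'k, of "x # path_word u p" w "[]"] w by simp
  next
    case *: (2 u' p')
    have "clw (w @ x # path_word u p) k = clw (w @ path_word u' p') k" for k :: 'k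
      using clw_context[of "x # path_word u p" "path_word u' p'" w "[]" k] *(3) w by simp
    moreover have "length w \<le> length p' \<or> out_arcs G v = {}" using snoc.prems(3) *(2) by auto
    ultimately show ?thesis using snoc.IH[OF w *(1)] by simp
  qed
qed

lemma clw_ghost_path:
  assumes "awalk u p v" "awalk u q w" "length p \<le> length q"
  shows "clw (map Ghost (rev p) @ path_word u q) (k::'k::field)
    = (if take (length p) q = p then clw (path_word v (drop (length p) q)) k else cl 0)"
  using assms
proof (induction p arbitrary: u q)
  case Nil
  then show ?case by (simp add: awalk_Nil_iff)
next
  case (Cons e p)
  then obtain f r where q: "q = f # r" by (cases q) auto
  have e: "e \<in> arcs G" "u = tail G e" "awalk (head G e) p v"
    and f: "f \<in> arcs G" "tail G f = u" "awalk (head G f) r w"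
    using Cons.prems by (auto simp: awalk_simps q)
  have gp: "map Ghost (rev p) \<in> lists gens" by (rule map_Ghost_in_lists[OF e(3)])
  have er: "map Edge r \<in> lists gens" by (rule map_Edge_in_lists[OF f(3)])
  have "clw (map Ghost (rev (e # p)) @ path_word u q) k
      = clw (map Ghost (rev p) @ [Ghost e, Edge f] @ map Edge r) k"
    using clw_context[OF clw_edge(4)[OF e(1)], of "map Ghost (rev p)" "map Edge q" k] e gp er f q
    by (simp add: path_word_def)
  also have "\<dots> = (if e = f then clw (map Ghost (rev p) @ path_word (head G e) r) k else cl 0)"
  proof (cases "e = f")
    case True
    then show ?thesis
      using clw_context[of "[Ghost e, Edge f]" "[Vertex (head G e)]" "map Ghost (rev p)" "map Edge r" k]
        clw_ghost_edge[OF e(1) f(1), where ?'k = 'k] gp er by (simp add: path_word_def)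
  next
    case False
    then show ?thesis
      using clw_context_zero[of "[Ghost e, Edge f]" "map Ghost (rev p)" "map Edge r" k]
        clw_ghost_edge[OF e(1) f(1), where ?'k = 'k] gp er by simp
  qed
  also have "\<dots> = (if take (length (e # p)) q = e # p
      then clw (path_word v (drop (length (e # p)) q)) k else cl 0)"
    using Cons.IH[OF e(3), of r] Cons.prems(3) f q by (cases "e = f") simp_all
  finally show ?case .
qed

subsection \<open>Linear combinations of paths\<close>

lemma path_sum_snoc_Vertex:
  assumes "\<forall>p\<in>A. awalk u p v"
  shows "cl (path_sum u A c * Poly_Mapping.single [Vertex v] 1) = cl (path_sum u A c)"
  unfolding path_sum_def sum_distrib_right
  by (rule cl_sum) (simp add: clw_path_snoc_Vertex assms)

lemma path_sum_ghost:
  assumes A: "\<forall>q\<in>A. awalk u q w" "finite A"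
    and p: "awalk u p v" "\<forall>q\<in>A. length p \<le> length q"
  shows "cl (Poly_Mapping.single (map Ghost (rev p)) 1 * path_sum u A c)
    = cl (path_sum v {r. p @ r \<in> A} (\<lambda>r. c (p @ r)))"
proof -
  let ?B = "{q \<in> A. take (length p) q = p}"
  let ?f = "\<lambda>q. Poly_Mapping.single (path_word v (drop (length p) q)) (c q)"
  have bij: "bij_betw (\<lambda>r. p @ r) {r. p @ r \<in> A} ?B"
    by (rule bij_betw_append)
  have "cl (Poly_Mapping.single (map Ghost (rev p)) 1 * path_sum u A c)
      = cl (\<Sum>q\<in>A. Poly_Mapping.single (map Ghost (rev p) @ path_word u q) (c q))"
    by (simp add: path_sum_def sum_distrib_left)
  also have "\<dots> = cl (\<Sum>q\<in>A. if take (length p) q = p then ?f q else 0)"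
  proof (rule cl_sum)
    fix q assume "q \<in> A"
    then show "clw (map Ghost (rev p) @ path_word u q) (c q)
        = cl (if take (length p) q = p then ?f q else 0)"
      using clw_ghost_path[OF p(1), of q w "c q"] A(1) p(2) by simp
  qed
  also have "(\<Sum>q\<in>A. if take (length p) q = p then ?f q else 0) = sum ?f ?B"
    using A(2) by (rule sum.inter_filter[symmetric])
  also have "\<dots> = path_sum v {r. p @ r \<in> A} (\<lambda>r. c (p @ r))"
    unfolding path_sum_def by (subst sum.reindex_bij_betw[OF bij, symmetric]) simp
  finally show ?thesis .
qed

lemma path_sum_prepend:
  assumes A: "\<forall>q\<in>A. awalk u q w" and p: "awalk u p v"
  shows "cl (Poly_Mapping.single (path_word u p) 1 * path_sum v {r. p @ r \<in> A} (\<lambda>r. c (p @ r)))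
    = cl (path_sum u {q \<in> A. take (length p) q = p} c)"
proof -
  have bij: "bij_betw (\<lambda>r. p @ r) {r. p @ r \<in> A} {q \<in> A. take (length p) q = p}"
    by (rule bij_betw_append)
  have r: "awalk v r w" if "p @ r \<in> A" for r
    using A that p by (metis awalk_append_iff awalk_ends)
  have "cl (Poly_Mapping.single (path_word u p) 1 * path_sum v {r. p @ r \<in> A} (\<lambda>r. c (p @ r)))
      = cl (\<Sum>r | p @ r \<in> A. Poly_Mapping.single (path_word u p @ path_word v r) (c (p @ r)))"
    by (simp add: path_sum_def sum_distrib_left)
  also have "\<dots> = cl (\<Sum>r | p @ r \<in> A. Poly_Mapping.single (path_word u (p @ r)) (c (p @ r)))"
    by (rule cl_sum) (simp add: clw_path_append[OF p r])
  also have "(\<Sum>r | p @ r \<in> A. Poly_Mapping.single (path_word u (p @ r)) (c (p @ r)))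
      = path_sum u {q \<in> A. take (length p) q = p} c"
    unfolding path_sum_def by (subst sum.reindex_bij_betw[OF bij, symmetric]) simp
  finally show ?thesis .
qed

lemma path_sum_snoc_Edge:
  "path_sum u A c * Poly_Mapping.single [Edge e] 1
    = path_sum u ((\<lambda>t. t @ [e]) ` A) (\<lambda>t. c (butlast t))"
proof -
  have "inj_on (\<lambda>t. t @ [e]) A" by (simp add: inj_on_def)
  then show ?thesis
    unfolding path_sum_def sum_distrib_right
    by (subst sum.reindex) (simp_all add: path_word_def)
qed

lemma path_sum_cycle:
  assumes "finite T" "[] \<in> T" "c [] \<noteq> (0::'k::field)" "awalk v p v" "p \<noteq> []"
    and power: "\<forall>t\<in>T. \<exists>m. t = concat (replicate m p)"
  shows "\<exists>m d. cl (path_sum v T c) = cl (free_scale (c [])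
    (vtx v + (\<Sum>k=1..m. free_scale (d k :: 'k) (prod_list (map edge p) ^ k))))"
proof -
  define P where "P = (\<lambda>m. concat (replicate m p))"
  define N where "N = {m. P m \<in> T}"
  have len: "length (P m) = m * length p" for m
    by (induction m) (auto simp: P_def)
  have inj: "inj P"
    using len assms(5) by (intro injI) (metis length_0_conv mult_cancel2)
  have "T = P ` N" using power by (auto simp: N_def P_def)
  then have "finite N" using assms(1) inj by (metis finite_imageD inj_on_subset subset_UNIV)
  then obtain M where M: "N \<subseteq> {..M}" using finite_nat_iff_bounded_le by auto
  define d where "d = (\<lambda>m. if m \<in> N then c (P m) / c [] else 0)"
  have P0: "P 0 = []" by (simp add: P_def)
  have walk: "awalk v (P m) v" for m
    using assms(4) by (induction m) (auto simp: P_def awalk_Nil_iff)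
  have g: "prod_list (map edge p) = Poly_Mapping.single (map Edge p) (1::'k)"
    by (induction p) (simp_all add: free_gen_def single_Nil_one)
  have gm: "prod_list (map edge p) ^ m = Poly_Mapping.single (map Edge (P m)) (1::'k)" for m
    by (induction m) (simp_all add: g P_def single_Nil_one)
  have "path_sum v T c = (\<Sum>m\<in>N. Poly_Mapping.single (path_word v (P m)) (c (P m)))"
    unfolding path_sum_def \<open>T = P ` N\<close>
    by (subst sum.reindex) (auto intro: inj_on_subset[OF inj])
  also have "\<dots> = (\<Sum>m\<le>M. Poly_Mapping.single (path_word v (P m)) (c [] * d m))"
    using M assms(3) by (intro sum.mono_neutral_cong_left) (auto simp: d_def)
  also have "{..M} = insert 0 {1..M}" by auto
  also have "(\<Sum>m\<in>\<dots>. Poly_Mapping.single (path_word v (P m)) (c [] * d m))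
      = Poly_Mapping.single [Vertex v] (c [] * d 0)
        + (\<Sum>m=1..M. Poly_Mapping.single (path_word v (P m)) (c [] * d m))"
    by (simp add: P0)
  also have "d 0 = 1" using assms(2,3) by (simp add: d_def N_def P0)
  finally have 1: "path_sum v T c = free_scale (c []) (vtx v)
        + (\<Sum>m=1..M. Poly_Mapping.single (path_word v (P m)) (c [] * d m))"
    by (simp add: free_scale_single free_gen_def)
  have "cl (\<Sum>m=1..M. Poly_Mapping.single (path_word v (P m)) (c [] * d m))
      = cl (\<Sum>m=1..M. free_scale (c []) (free_scale (d m) (prod_list (map edge p) ^ m)))"
  proof (rule cl_sum)
    fix m assume "m \<in> {1..M}"
    then have "P m \<noteq> []" using len[of m] assms(5) by auto
    then show "clw (path_word v (P m)) (c [] * d m)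
        = cl (free_scale (c []) (free_scale (d m) (prod_list (map edge p) ^ m)))"
      by (simp add: gm free_scale_single clw_map_Edge[OF walk])
  qed
  from cl_add[OF refl this, of "free_scale (c []) (vtx v)"] 1
  have "cl (path_sum v T c) = cl (free_scale (c [])
    (vtx v + (\<Sum>k=1..M. free_scale (d k :: 'k) (prod_list (map edge p) ^ k))))"
    by (simp add: free_scale_conv_mult distrib_left sum_distrib_left)
  then show ?thesis by blast
qed

subsection \<open>Closed walks on which the tail determines the edge\<close>

lemma closed_walk_distinct_tails:
  assumes "awalk v p v" "p \<noteq> []"
    and shortest: "\<And>q. awalk v q v \<Longrightarrow> q \<noteq> [] \<Longrightarrow> set q \<subseteq> set p \<Longrightarrow> length p \<le> length q"
  shows "distinct (map (tail G) p)"
proof (rule ccontr)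
  assume "\<not> ?thesis"
  then obtain xs ys zs y where "map (tail G) p = xs @ [y] @ ys @ [y] @ zs"
    using not_distinct_decomp by blast
  then obtain a e b f c where p: "p = a @ e # b @ f # c" and "tail G e = tail G f"
    by (auto simp: map_eq_append_conv append_eq_map_conv Cons_eq_map_conv)
  then have "awalk v (a @ f # c) v"
    using assms(1) by (auto simp: awalk_simps)
  then show False
    using shortest[of "a @ f # c"] p by auto
qed

lemma deterministic_walk_prefix:
  assumes "awalk u p v" "awalk u q w" "length p \<le> length q"
    and "inj_on (tail G) S" "set p \<subseteq> S" "set q \<subseteq> S"
  shows "take (length p) q = p"
  using assms
proof (induction p arbitrary: u q)
  case (Cons e p)
  then obtain f r where q: "q = f # r" by (cases q) auto
  moreover have "e = f"
    using Cons.prems q by (auto simp: awalk_simps inj_on_def)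
  ultimately show ?case
    using Cons.IH[of "head G e" r] Cons.prems by (auto simp: awalk_simps)
qed simp

lemma closed_walk_power:
  assumes "inj_on (tail G) S" "awalk v p v" "set p \<subseteq> S"
    and shortest: "\<And>q. awalk v q v \<Longrightarrow> q \<noteq> [] \<Longrightarrow> set q \<subseteq> S \<Longrightarrow> length p \<le> length q"
    and "p \<noteq> []" "awalk v q v" "set q \<subseteq> S"
  shows "\<exists>m. q = concat (replicate m p)"
  using assms(6,7)
proof (induction "length q" arbitrary: q rule: less_induct)
  case less
  show ?case
  proof (cases "q = []")
    case True
    then show ?thesis by (intro exI[of _ 0]) simp
  next
    case False
    then have "take (length p) q = p"
      using deterministic_walk_prefix[OF assms(2) less.prems(1) _ assms(1,3) less.prems(2)]
        shortest less.prems by simp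
    then obtain r where q: "q = p @ r" by (metis append_take_drop_id)
    then have "awalk v r v"
      using less.prems(1) assms(2) by (metis awalk_append_iff awalk_ends)
    moreover have "length r < length q" using q assms(5) by simp
    ultimately obtain m where "r = concat (replicate m p)"
      using less.hyps[of r] less.prems(2) q by auto
    then show ?thesis using q by (intro exI[of _ "Suc m"]) simp
  qed
qed

end

section \<open>Ideals\<close>

locale lpa_ideal = wf_digraph G for G :: "('v, 'e) pre_digraph" +
  fixes J :: "('v, 'e, 'k::field) free_alg set set"
  assumes ideal: "two_sided_ideal (leavitt_path_algebra G :: ('k, _) nu_algebra) J"
begin

lemma in_carrier: "cl p \<in> J \<Longrightarrow> p \<in> free_carrier G"
proof -
  assume "cl p \<in> J"
  then obtain q where "q \<in> free_carrier G" "cl p = cl q"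
    using ideal by (auto simp: two_sided_ideal_def leavitt_path_algebra_def)
  then show ?thesis
    using free_carrier_add[of q G "p - q"] lpa_kernel_carrier[OF wf_digraph_axioms, of "p - q"]
    by (simp add: lpa_class_eq_iff)
qed

lemma zero: "cl 0 \<in> J"
  using ideal by (simp add: two_sided_ideal_def leavitt_path_algebra_def)

lemma add: "cl p \<in> J \<Longrightarrow> cl q \<in> J \<Longrightarrow> cl (p + q) \<in> J"
  using ideal by (metis two_sided_ideal_def lpa_add_class)

lemma diff: "cl p \<in> J \<Longrightarrow> cl q \<in> J \<Longrightarrow> cl (p - q) \<in> J"
  using ideal add[of p "- q"] by (metis two_sided_ideal_def lpa_neg_class uminus_add_conv_diff add.commute)

lemma sum: "(\<And>a. a \<in> A \<Longrightarrow> cl (f a) \<in> J) \<Longrightarrow> cl (sum f A) \<in> J"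
  by (induction A rule: infinite_finite_induct) (simp_all add: zero add)

lemma mult:
  assumes "cl p \<in> J" "q \<in> free_carrier G"
  shows "cl (q * p) \<in> J" "cl (p * q) \<in> J"
proof -
  have "cl q \<in> na_carrier (leavitt_path_algebra G)"
    using assms(2) by (simp add: leavitt_path_algebra_def)
  then show "cl (q * p) \<in> J" "cl (p * q) \<in> J"
    using ideal assms in_carrier[OF assms(1)] lpa_mult_class[OF wf_digraph_axioms]
    by (metis two_sided_ideal_def)+
qed

lemma single_in_carrier: "w \<in> lists gens \<Longrightarrow> w \<noteq> [] \<Longrightarrow> Poly_Mapping.single w k \<in> free_carrier G"
  by (auto simp: free_carrier_def)

lemma scale: "cl p \<in> J \<Longrightarrow> cl (free_scale k p) \<in> J"
proof -
  assume p: "cl p \<in> J"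
  from local_unit_left[OF in_carrier[OF p], of k] obtain F where
    F: "F \<subseteq> verts G" "cl (free_scale k p) = cl (\<Sum>v\<in>F. Poly_Mapping.single [Vertex v] k * p)"
    by metis
  have "cl (\<Sum>v\<in>F. Poly_Mapping.single [Vertex v] k * p) \<in> J"
    using F(1) by (intro sum mult p single_in_carrier) auto
  then show ?thesis using F by simp
qed

lemma single_left: "cl p \<in> J \<Longrightarrow> w \<in> lists gens \<Longrightarrow> cl (Poly_Mapping.single w k * p) \<in> J"
  using scale[of p k] mult(1)[of p "Poly_Mapping.single w k"] single_in_carrier
  by (cases "w = []") (auto simp: free_scale_conv_mult)

lemma single_right: "cl p \<in> J \<Longrightarrow> w \<in> lists gens \<Longrightarrow> cl (p * Poly_Mapping.single w k) \<in> J"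
  using scale[of p k] mult(2)[of p "Poly_Mapping.single w k"] single_in_carrier
  by (cases "w = []") (auto simp: free_scale_conv_mult single_Nil_commute)

lemma left_vertices:
  assumes "p \<in> free_carrier G" "\<And>v. v \<in> verts G \<Longrightarrow> cl (Poly_Mapping.single [Vertex v] 1 * p) \<in> J"
  shows "cl p \<in> J"
proof -
  from local_unit_left[OF assms(1), of 1] obtain F where
    F: "F \<subseteq> verts G" "cl (free_scale 1 p) = cl (\<Sum>v\<in>F. Poly_Mapping.single [Vertex v] 1 * p)"
    by metis
  have "cl (\<Sum>v\<in>F. Poly_Mapping.single [Vertex v] 1 * p) \<in> J"
    using F(1) by (intro sum assms) auto
  then show ?thesis using F(2) by (simp add: free_scale_conv_mult single_Nil_one)
qed

lemma right_vertices:
  assumes "p \<in> free_carrier G" "\<And>v. v \<in> verts G \<Longrightarrow> cl (p * Poly_Mapping.single [Vertex v] 1) \<in> J"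
  shows "cl p \<in> J"
proof -
  from local_unit_right[OF assms(1)] obtain F where
    F: "F \<subseteq> verts G" "cl p = cl (\<Sum>v\<in>F. p * Poly_Mapping.single [Vertex v] 1)"
    by metis
  have "cl (\<Sum>v\<in>F. p * Poly_Mapping.single [Vertex v] 1) \<in> J"
    using F(1) by (intro sum assms) auto
  then show ?thesis using F(2) by simp
qed

lemma right_edges:
  assumes "p \<in> free_carrier G" "v \<in> verts G" "out_arcs G v \<noteq> {}" "finite (out_arcs G v)"
    and "cl (p * Poly_Mapping.single [Vertex v] 1) = cl p"
    and "\<And>e. e \<in> arcs G \<Longrightarrow> tail G e = v \<Longrightarrow> cl (p * Poly_Mapping.single [Edge e] 1) \<in> J"
  shows "cl p \<in> J"
proof -
  let ?s = "\<Sum>e\<in>out_arcs G v. Poly_Mapping.single [Edge e, Ghost e] (1::'k)"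
  have "Poly_Mapping.single [Vertex v] 1 - ?s \<in> lpa_kernel G"
    using clw_vertex[OF assms(2-4)] by (simp add: lpa_class_eq_iff)
  then have "cl (p * Poly_Mapping.single [Vertex v] 1) = cl (p * ?s)"
    using lpa_kernel.mult_left[OF assms(1), of "Poly_Mapping.single [Vertex v] 1 - ?s"]
    by (simp add: lpa_class_eq_iff right_diff_distrib)
  also have "p * ?s = (\<Sum>e\<in>out_arcs G v.
      p * Poly_Mapping.single [Edge e] 1 * Poly_Mapping.single [Ghost e] 1)"
    by (simp add: sum_distrib_left mult.assoc)
  also have "cl \<dots> \<in> J"
    by (intro sum single_right assms(6)) (auto simp: out_arcs_def)
  finally show ?thesis using assms(5) by simp
qed

lemma vertex_reachable:
  assumes "clw [Vertex u] (1::'k) \<in> J" "awalk u p v"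
  shows "clw [Vertex v] (1::'k) \<in> J"
proof -
  have u: "u \<in> verts G" using assms(2) by auto
  have "clw (map Ghost (rev p) @ [Vertex u] @ path_word u p) (1::'k) \<in> J"
    using single_right[OF single_left[OF assms(1) map_Ghost_in_lists[OF assms(2)], of 1]
        path_word_in_lists[OF assms(2)], of 1] by simp
  moreover have "clw (map Ghost (rev p) @ [Vertex u] @ path_word u p) (1::'k)
      = clw (map Ghost (rev p) @ path_word u p) 1"
    using clw_context[of "[Vertex u] @ path_word u p" "path_word u p" "map Ghost (rev p)" "[]" 1]
      clw_Vertex_path[OF assms(2) u, of 1] map_Ghost_in_lists[OF assms(2)] by simp
  moreover have "\<dots> = clw [Vertex v] 1"
    using clw_ghost_path[OF assms(2,2), of 1] by simp
  ultimately show ?thesis by simp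
qed

end

section \<open>Comparing two ideals\<close>

locale lpa_ideal_comparison = I: lpa_ideal G I + J: lpa_ideal G J
  for G :: "('v, 'e) pre_digraph" and I J :: "('v, 'e, 'k::field) free_alg set set" +
  assumes row_finite: "row_finite G"
    and generators: "\<And>v g m (c :: nat \<Rightarrow> 'k). v \<in> verts G \<Longrightarrow> cycle_element G v g \<Longrightarrow>
      I.cl (vtx v + (\<Sum>k=1..m. free_scale (c k) (g ^ k))) \<in> I \<Longrightarrow>
      I.cl (vtx v + (\<Sum>k=1..m. free_scale (c k) (g ^ k))) \<in> J"
begin

lemma vertex_in_J:
  assumes "v \<in> verts G" "I.clw [Vertex v] (1::'k) \<in> I"
  shows "I.clw [Vertex v] (1::'k) \<in> J"
proof -
  obtain g :: "('v, 'e, 'k) free_alg" where "cycle_element G v g"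
    unfolding cycle_element_def by blast
  from generators[OF assms(1) this, where m = 0] assms(2) show ?thesis
    by (simp add: free_gen_def)
qed

lemma scaled_vertex_in_J:
  assumes "v \<in> verts G" "I.clw [Vertex v] (k::'k) \<in> I"
  shows "I.clw [Vertex v] (k::'k) \<in> J"
proof (cases "k = 0")
  case True
  then show ?thesis by (simp add: J.zero)
next
  case False
  then have "I.clw [Vertex v] (1::'k) \<in> I"
    using I.scale[OF assms(2), of "inverse k"] by (simp add: free_scale_single)
  from J.scale[OF vertex_in_J[OF assms(1) this], of k] show ?thesis
    by (simp add: free_scale_single)
qed

definition discrepancy :: "'v \<Rightarrow> 'v \<Rightarrow> 'e list set \<Rightarrow> ('e list \<Rightarrow> 'k) \<Rightarrow> bool" where
  "discrepancy u v A c \<longleftrightarrow> finite A \<and> (\<forall>p\<in>A. I.awalk u p v) \<and>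
     I.cl (path_sum u A c) \<in> I \<and> I.cl (path_sum u A c) \<notin> J"

lemma discrepancy_exists:
  assumes x: "I.cl x \<in> I" "I.cl x \<notin> J"
  shows "\<exists>u v A c. discrepancy u v A c"
proof -
  have long: "\<exists>u p v. I.awalk u p v \<and> (length p = n \<or> out_arcs G v = {}) \<and>
      I.cl (x * Poly_Mapping.single (path_word u p) 1) \<notin> J" for n
  proof (induction n)
    case 0
    obtain v where "v \<in> verts G" "I.cl (x * Poly_Mapping.single [Vertex v] 1) \<notin> J"
      using J.right_vertices[OF I.in_carrier[OF x(1)]] x(2) by blast
    then show ?case
      by (intro exI[of _ v] exI[of _ "[]"]) (simp add: I.awalk_Nil_iff)
  next
    case (Suc n)
    then obtain u p v where p: "I.awalk u p v" "length p = n \<or> out_arcs G v = {}"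
      and notin: "I.cl (x * Poly_Mapping.single (path_word u p) 1) \<notin> J" by blast
    show ?case
    proof (cases "out_arcs G v = {}")
      case True
      then show ?thesis using p notin by blast
    next
      case False
      let ?z = "x * Poly_Mapping.single (path_word u p) (1::'k)"
      have v: "v \<in> verts G" using p(1) by auto
      have "I.cl ?z \<in> I"
        by (rule I.single_right[OF x(1) I.path_word_in_lists[OF p(1)]])
      then have z: "?z \<in> free_carrier G" by (rule I.in_carrier)
      have "I.cl (x * (Poly_Mapping.single (path_word u p @ [Vertex v]) 1
          - Poly_Mapping.single (path_word u p) (1::'k))) = I.cl 0"
        using lpa_kernel.mult_left[OF I.in_carrier[OF x(1)]] I.clw_path_snoc_Vertex[OF p(1), of 1]
        by (simp add: lpa_class_eq_iff)
      then have "I.cl (?z * Poly_Mapping.single [Vertex v] 1) = I.cl ?z"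
        by (simp add: lpa_class_eq_iff right_diff_distrib mult.assoc)
      from J.right_edges[OF z v False _ this] notin row_finite v
      obtain e where e: "e \<in> arcs G" "tail G e = v"
        "I.cl (?z * Poly_Mapping.single [Edge e] 1) \<notin> J"
        unfolding row_finite_def by blast
      have "I.awalk u (p @ [e]) (head G e)"
        using p(1) e by (auto simp: I.awalk_simps)
      moreover have "?z * Poly_Mapping.single [Edge e] 1
          = x * Poly_Mapping.single (path_word u (p @ [e])) 1"
        by (simp add: mult.assoc path_word_def)
      moreover have "length (p @ [e]) = Suc n" using p(2) False by simp
      ultimately show ?thesis using e(3) by metis
    qed
  qed
  define K where "K = Poly_Mapping.keys x"
  define k where "k = Poly_Mapping.lookup x"
  have xsum: "x = (\<Sum>w\<in>K. Poly_Mapping.single w (k w))"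
    unfolding K_def k_def by (rule poly_mapping_eq_sum_single)
  have "finite K" by (simp add: K_def)
  have K: "w \<in> lists I.gens" if "w \<in> K" for w
    using that I.in_carrier[OF x(1)] by (auto simp: K_def free_carrier_def)
  obtain u p v where p: "I.awalk u p v" "length p = sum length K \<or> out_arcs G v = {}"
    and notin: "I.cl (x * Poly_Mapping.single (path_word u p) 1) \<notin> J"
    using long by blast
  let ?z = "x * Poly_Mapping.single (path_word u p) (1::'k)"
  have z: "I.cl ?z \<in> I"
    by (rule I.single_right[OF x(1) I.path_word_in_lists[OF p(1)]])
  obtain s where s: "s \<in> verts G" "I.cl (Poly_Mapping.single [Vertex s] 1 * ?z) \<notin> J"
    using J.left_vertices[OF I.in_carrier[OF z]] notin by blast
  have s': "I.cl (Poly_Mapping.single [Vertex s] 1 * ?z) \<in> I"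
    by (rule I.single_left[OF z]) (use s in simp)
  have eq: "Poly_Mapping.single [Vertex s] 1 * ?z
      = (\<Sum>w\<in>K. Poly_Mapping.single (Vertex s # w @ path_word u p) (k w))"
    by (subst xsum) (simp add: sum_distrib_left sum_distrib_right)
  have "\<exists>y. Poly_Mapping.keys y \<subseteq> path_word s ` {q. I.awalk s q v} \<and>
      I.clw (Vertex s # w @ path_word u p) (k w) = I.cl y" if w: "w \<in> K" for w
  proof -
    have "length w \<le> sum length K" using \<open>finite K\<close> w by (simp add: member_le_sum)
    with p(2) have "length w \<le> length p \<or> out_arcs G v = {}" by auto
    from I.clw_word_path_cases[where ?'k = 'k, OF K[OF w] p(1) this]
    consider "\<forall>k::'k. I.clw (w @ path_word u p) k = I.cl 0"
      | u' p' where "I.awalk u' p' v" "\<forall>k::'k. I.clw (w @ path_word u p) k = I.clw (path_word u' p') k"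
      by blast
    then show ?thesis
    proof cases
      case 1
      then have "I.clw (Vertex s # w @ path_word u p) (k w) = I.cl 0"
        using I.clw_context_zero[where ?'k = 'k, of "w @ path_word u p" "[Vertex s]" "[]" "k w"] s(1)
        by simp
      then show ?thesis by (intro exI[of _ 0]) simp
    next
      case (2 u' p')
      have "I.clw (Vertex s # w @ path_word u p) (k w) = I.clw (Vertex s # path_word u' p') (k w)"
        using I.clw_context[where ?'k = 'k, of "w @ path_word u p" "path_word u' p'" "[Vertex s]" "[]" "k w"] s(1) 2(2)
        by simp
      also have "\<dots> = I.cl (if s = u' then Poly_Mapping.single (path_word u' p') (k w) else 0)"
        using I.clw_Vertex_path[OF 2(1) s(1), of "k w"] by simp
      finally show ?thesis
        using 2(1)
        by (intro exI[of _ "if s = u' then Poly_Mapping.single (path_word u' p') (k w) else 0"]) simp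
    qed
  qed
  then obtain y where y: "\<And>w. w \<in> K \<Longrightarrow> Poly_Mapping.keys (y w) \<subseteq> path_word s ` {q. I.awalk s q v}"
    "\<And>w. w \<in> K \<Longrightarrow> I.clw (Vertex s # w @ path_word u p) (k w) = I.cl (y w)"
    by metis
  define Y where "Y = sum y K"
  have cly: "I.cl (Poly_Mapping.single [Vertex s] 1 * ?z) = I.cl Y"
    unfolding eq Y_def by (rule I.cl_sum) (rule y)
  define A where "A = {q. path_word s q \<in> Poly_Mapping.keys Y}"
  have keysY: "Poly_Mapping.keys Y \<subseteq> path_word s ` {q. I.awalk s q v}"
    unfolding Y_def using keys_sum[of y K] y(1) by blast
  then have A: "Poly_Mapping.keys Y = path_word s ` A" "\<forall>q\<in>A. I.awalk s q v"
    by (auto simp: A_def)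
  have inj: "inj_on (path_word s) A" by (simp add: inj_on_def)
  have "finite A" using A(1) inj by (metis finite_imageD finite_keys)
  have "Y = (\<Sum>w\<in>path_word s ` A. Poly_Mapping.single w (Poly_Mapping.lookup Y w))"
    using poly_mapping_eq_sum_single[of Y] unfolding A(1) .
  also have "\<dots> = path_sum s A (\<lambda>q. Poly_Mapping.lookup Y (path_word s q))"
    unfolding path_sum_def by (subst sum.reindex[OF inj]) simp
  finally have "Y = path_sum s A (\<lambda>q. Poly_Mapping.lookup Y (path_word s q))" .
  then show ?thesis
    using s(2) s' cly A(2) \<open>finite A\<close> unfolding discrepancy_def by metis
qed

context
  fixes n :: nat
  assumes minimal: "\<And>u v A c. discrepancy u v A c \<Longrightarrow> n \<le> card A"
begin

text \<open>
  For a shortest path \<open>p\<close>, multiplying by \<open>p\<^sup>*\<close> and then by \<open>p\<close> projects onto the terms with prefix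
  \<open>p\<close>. If this were a proper subset of the terms, both parts would be smaller and hence in \<open>J\<close>.
\<close>

lemma discrepancy_factor:
  assumes d: "discrepancy u w A c" "card A = n" and p: "p \<in> A" "\<forall>q\<in>A. length p \<le> length q"
  shows "\<forall>q\<in>A. take (length p) q = p"
    and "discrepancy w w {r. p @ r \<in> A} (\<lambda>r. c (p @ r))"
proof -
  let ?B = "{q \<in> A. take (length p) q = p}"
  let ?D = "{r. p @ r \<in> A}" and ?c = "\<lambda>r. c (p @ r)"
  let ?C = "A - ?B"
  have A: "finite A" "\<forall>q\<in>A. I.awalk u q w"
    and y: "I.cl (path_sum u A c) \<in> I" "I.cl (path_sum u A c) \<notin> J"
    using d(1) by (auto simp: discrepancy_def)
  have pw: "I.awalk u p w" using A(2) p(1) by blast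
  have D: "I.awalk w r w" if "r \<in> ?D" for r
    using A(2) pw that by (metis I.awalk_append_iff I.awalk_ends mem_Collect_eq)
  have cardD: "card ?D = card ?B" and finD: "finite ?D"
    using bij_betw_append[of p A] A(1) by (auto dest: bij_betw_same_card bij_betw_finite)
  have DI: "I.cl (path_sum w ?D ?c) \<in> I"
    using I.single_left[OF y(1) I.map_Ghost_in_lists[OF pw], of 1]
    unfolding I.path_sum_ghost[OF A(2,1) pw p(2)] .
  have BI: "I.cl (path_sum u ?B c) \<in> I"
    using I.single_left[OF DI I.path_word_in_lists[OF pw], of 1]
    unfolding I.path_sum_prepend[OF A(2) pw] .
  have BJ: "I.cl (path_sum u ?B c) \<in> J" if "I.cl (path_sum w ?D ?c) \<in> J"
    using J.single_left[OF that I.path_word_in_lists[OF pw], of 1]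
    unfolding I.path_sum_prepend[OF A(2) pw] .
  have AB: "path_sum u A c = path_sum u ?B c + path_sum u ?C c"
    unfolding path_sum_def using A(1) by (subst sum.subset_diff[of ?B]) auto
  have C: "?C = {}"
  proof (rule ccontr)
    assume "?C \<noteq> {}"
    then have "?B \<subset> A" by auto
    then have "card ?B < n" using A(1) d(2) by (metis psubset_card_mono)
    moreover have "card ?C < n"
    proof -
      have "p \<in> ?B" using p(1) by simp
      then have "?C \<subset> A" by blast
      then show ?thesis using A(1) d(2) by (metis psubset_card_mono)
    qed
    ultimately have no: "\<not> discrepancy w w ?D ?c" "\<not> discrepancy u w ?C c"
      using minimal[of w w ?D ?c] minimal[of u w ?C c] cardD by linarith+
    have B: "I.cl (path_sum u ?B c) \<in> J"
      using no(1) D DI finD BJ unfolding discrepancy_def by blast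
    have "path_sum u ?C c = path_sum u A c - path_sum u ?B c" using AB by simp
    then have "I.cl (path_sum u ?C c) \<in> I" using I.diff[OF y(1) BI] by simp
    then have "I.cl (path_sum u ?C c) \<in> J"
      using no(2) A unfolding discrepancy_def by blast
    with B y(2) show False unfolding AB by (blast dest: J.add)
  qed
  then show "\<forall>q\<in>A. take (length p) q = p" by blast
  from C have "?B = A" by blast
  then show "discrepancy w w ?D ?c"
    using BJ DI D finD y(2) unfolding discrepancy_def by auto
qed

lemma discrepancy_coeff_nonzero:
  assumes "discrepancy u v A c" "card A = n" "p \<in> A"
  shows "c p \<noteq> 0"
proof
  assume "c p = 0"
  have A: "finite A" using assms(1) by (simp add: discrepancy_def)
  have "path_sum u A c = path_sum u (A - {p}) c"
    unfolding path_sum_def using \<open>c p = 0\<close> A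
    by (intro sum.mono_neutral_right) auto
  then have "discrepancy u v (A - {p}) c"
    using assms(1) by (simp add: discrepancy_def)
  from minimal[OF this] show False
    using assms A by (metis card_Diff1_less not_le)
qed

text \<open>
  Some edge \<open>e\<close> keeps the product with the combination outside \<open>J\<close>, and factoring \<open>e\<close> out on the left
  rotates all closed paths. For any other edge \<open>f\<close> at \<open>v\<close>, conjugation by \<open>f\<close> leaves a multiple of the
  vertex \<open>head G f\<close>, which is thus in \<open>J\<close>; if one of the closed paths used \<open>f\<close>, then \<open>v\<close> would be
  reachable from there and be in \<open>J\<close>, too.
\<close>

lemma discrepancy_rotate1:
  assumes d: "discrepancy v v T c" "card T = n" and Nil: "[] \<in> T"
  obtains e c' where "e \<in> arcs G" "\<And>t. t \<in> T \<Longrightarrow> t \<noteq> [] \<Longrightarrow> hd t = e"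
    "\<And>t f. t \<in> T \<Longrightarrow> f \<in> set t \<Longrightarrow> tail G f = tail G e \<Longrightarrow> f = e"
    "discrepancy (head G e) (head G e) (rotate1 ` T) c'"
proof -
  have T: "finite T" "\<forall>t\<in>T. I.awalk v t v"
    and y: "I.cl (path_sum v T c) \<in> I" "I.cl (path_sum v T c) \<notin> J"
    using d(1) by (auto simp: discrepancy_def)
  have v: "v \<in> verts G" using T(2) Nil by auto
  have vJ: "I.clw [Vertex v] (1::'k) \<notin> J"
  proof
    assume "I.clw [Vertex v] (1::'k) \<in> J"
    then have "I.cl (path_sum v T c * Poly_Mapping.single [Vertex v] 1) \<in> J"
      by (rule J.mult(1)[OF _ I.in_carrier[OF y(1)]])
    then show False using y(2) I.path_sum_snoc_Vertex[OF T(2), of c] by simp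
  qed
  have "T \<noteq> {[]}"
  proof
    assume "T = {[]}"
    then have "path_sum v T c = Poly_Mapping.single [Vertex v] (c [])"
      by (simp add: path_sum_def)
    then show False using scaled_vertex_in_J[OF v] y by simp
  qed
  then obtain f t where "f # t \<in> T"
    using Nil by (metis insert_absorb neq_Nil_conv singleton_insert_inj_eq subsetI subset_singletonD
        empty_iff insert_iff)
  then have "f \<in> out_arcs G v"
    using T(2) by (auto simp: I.awalk_simps)
  then have "out_arcs G v \<noteq> {}" by auto
  with J.right_edges[OF I.in_carrier[OF y(1)] v] I.path_sum_snoc_Vertex[OF T(2), of c] y(2)
    row_finite v
  obtain e where e: "e \<in> arcs G" "tail G e = v"
    "I.cl (path_sum v T c * Poly_Mapping.single [Edge e] 1) \<notin> J"
    unfolding row_finite_def by blast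
  let ?w = "head G e"
  let ?A = "(\<lambda>t. t @ [e]) ` T" and ?c = "\<lambda>t. c (butlast t)"
  have "I.cl (path_sum v T c * Poly_Mapping.single [Edge e] 1) \<in> I"
    by (rule I.single_right[OF y(1)]) (use e in simp)
  then have dA: "discrepancy v ?w ?A ?c"
    using e T I.arc_implies_awalk[OF e(1)] unfolding discrepancy_def I.path_sum_snoc_Edge
    by (auto intro: I.awalk_appendI)
  have cardA: "card ?A = n"
    using d(2) by (simp add: card_image inj_on_def)
  have eA: "[e] \<in> ?A" using Nil by force
  have le: "\<forall>q\<in>?A. length [e] \<le> length q" by auto
  note factor = discrepancy_factor[OF dA cardA eA le]
  have hd: "hd t = e" if "t \<in> T" "t \<noteq> []" for t
    using factor(1) that by (cases t) auto
  have "{r. [e] @ r \<in> ?A} = rotate1 ` T"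
  proof (intro equalityI subsetI)
    fix r assume "r \<in> {r. [e] @ r \<in> ?A}"
    then obtain t where t: "t \<in> T" "e # r = t @ [e]" by auto
    then have "r = rotate1 t" by (cases t) auto
    then show "r \<in> rotate1 ` T" using t by blast
  next
    fix r assume "r \<in> rotate1 ` T"
    then obtain t where t: "t \<in> T" "r = rotate1 t" by auto
    then have "[e] @ r = t @ [e]" using hd[of t] by (cases t) auto
    then show "r \<in> {r. [e] @ r \<in> ?A}" using t by auto
  qed
  with factor(2) have rot: "discrepancy ?w ?w (rotate1 ` T) (\<lambda>r. ?c ([e] @ r))" by simp
  have "f = e" if "t \<in> T" "f \<in> set t" "tail G f = v" for t f
  proof (rule ccontr)
    assume ne: "f \<noteq> e"
    obtain a b where t: "t = a @ f # b" using \<open>f \<in> set t\<close> by (metis split_list)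
    then have f: "f \<in> arcs G" and b: "I.awalk (head G f) b v"
      using T(2) \<open>t \<in> T\<close> by (auto simp: I.awalk_simps)
    let ?F = "(\<lambda>t. t @ [f]) ` T"
    have fw: "I.awalk v [f] (head G f)"
      using f \<open>tail G f = v\<close> by (auto simp: I.awalk_simps)
    then have F: "\<forall>q\<in>?F. I.awalk v q (head G f)" "\<forall>q\<in>?F. length [f] \<le> length q"
      using T(2) by (auto intro: I.awalk_appendI)
    have D: "{r. [f] @ r \<in> ?F} = {[]}"
    proof (intro equalityI subsetI)
      fix r assume "r \<in> {r. [f] @ r \<in> ?F}"
      then obtain s where s: "s \<in> T" "f # r = s @ [f]" by auto
      then show "r \<in> {[]}" using hd[of s] ne by (cases s) auto
    qed (use Nil in force)
    have FI: "I.cl (path_sum v ?F ?c) \<in> I"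
      using I.single_right[OF y(1), of "[Edge f]" 1] f unfolding I.path_sum_snoc_Edge by simp
    have "I.cl (path_sum (head G f) {r. [f] @ r \<in> ?F} (\<lambda>r. ?c ([f] @ r))) \<in> I"
      using I.single_left[OF FI I.map_Ghost_in_lists[OF fw], of 1]
        I.path_sum_ghost[OF F(1) _ fw F(2), of ?c] T(1) by simp
    then have "I.clw [Vertex (head G f)] (c []) \<in> I"
      unfolding D by (simp add: path_sum_def)
    from scaled_vertex_in_J[OF I.head_in_verts[OF f] this]
    have "I.clw [Vertex (head G f)] (1::'k) \<in> J"
      using J.scale[of "Poly_Mapping.single [Vertex (head G f)] (c [])" "inverse (c [])"]
        discrepancy_coeff_nonzero[OF d Nil] by (simp add: free_scale_single)
    then show False using J.vertex_reachable[OF _ b] vJ by blast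
  qed
  then show thesis using that[OF e(1) hd _ rot] e(2) by blast
qed

lemma discrepancy_rotate:
  assumes d: "discrepancy v v T c" "card T = n" and Nil: "[] \<in> T"
  shows "\<exists>v' c'. discrepancy v' v' (rotate k ` T) c' \<and> card (rotate k ` T) = n \<and> [] \<in> rotate k ` T"
proof (induction k)
  case 0
  then show ?case using assms by (auto simp: id_def)
next
  case (Suc k)
  then obtain v' c' where IH: "discrepancy v' v' (rotate k ` T) c'" "card (rotate k ` T) = n"
    "[] \<in> rotate k ` T" by blast
  have eq: "rotate (Suc k) ` T = rotate1 ` (rotate k ` T)" by (simp add: image_comp)
  have "inj rotate1" by (rule inj_rotate1)
  then have "card (rotate1 ` (rotate k ` T)) = n"
    using IH(2) by (metis card_image inj_on_subset subset_UNIV)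
  moreover have "[] \<in> rotate1 ` (rotate k ` T)" using IH(3) by force
  ultimately show ?case
    unfolding eq using discrepancy_rotate1[OF IH] by metis
qed

lemma discrepancy_tails_inj:
  assumes "discrepancy v v T c" "card T = n" "[] \<in> T"
  shows "inj_on (tail G) (\<Union>t\<in>T. set t)"
proof (rule inj_onI)
  fix f g assume "f \<in> (\<Union>t\<in>T. set t)" "g \<in> (\<Union>t\<in>T. set t)" and fg: "tail G f = tail G g"
  then obtain t s where t: "t \<in> T" "f \<in> set t" and s: "s \<in> T" "g \<in> set s" by auto
  obtain a b where ab: "t = a @ f # b" using t(2) by (metis split_list)
  obtain v' c' where r: "discrepancy v' v' (rotate (length a) ` T) c'"
    "card (rotate (length a) ` T) = n" "[] \<in> rotate (length a) ` T"
    using discrepancy_rotate[OF assms] by blast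
  obtain e where e: "\<And>t. t \<in> rotate (length a) ` T \<Longrightarrow> t \<noteq> [] \<Longrightarrow> hd t = e"
    "\<And>t f. t \<in> rotate (length a) ` T \<Longrightarrow> f \<in> set t \<Longrightarrow> tail G f = tail G e \<Longrightarrow> f = e"
    by (rule discrepancy_rotate1[OF r]) blast
  have "rotate (length a) t = f # b @ a" using ab by (simp add: rotate_append)
  then have "f # b @ a \<in> rotate (length a) ` T" using t(1) by (metis imageI)
  then have "f = e" using e(1)[of "f # b @ a"] by simp
  moreover have "g = e" using e(2)[of "rotate (length a) s" g] s fg \<open>f = e\<close> by auto
  ultimately show "f = g" by simp
qed

lemma no_minimal_discrepancy:
  assumes "discrepancy u w A c" "card A = n"
  shows False
proof -
  have "A \<noteq> {}"
    using assms(1) J.zero by (auto simp: discrepancy_def path_sum_def)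
  then obtain p0 where p0: "p0 \<in> A" "\<forall>q\<in>A. length p0 \<le> length q"
    by (metis ex_has_least_nat[of "\<lambda>p. p \<in> A" _ length] ex_in_conv)
  define T where "T = {r. p0 @ r \<in> A}"
  define d where "d = (\<lambda>r. c (p0 @ r))"
  have T: "discrepancy w w T d"
    unfolding T_def d_def using discrepancy_factor(2)[OF assms p0] .
  have "{q \<in> A. take (length p0) q = p0} = A"
    using discrepancy_factor(1)[OF assms p0] by blast
  then have cardT: "card T = n"
    using bij_betw_same_card[OF bij_betw_append[of p0 A]] assms(2) by (simp add: T_def)
  have Nil: "[] \<in> T" using p0(1) by (simp add: T_def)
  have d0: "d [] \<noteq> 0" by (rule discrepancy_coeff_nonzero[OF T cardT Nil])
  have Tw: "finite T" "\<And>t. t \<in> T \<Longrightarrow> I.awalk w t w"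
    and TI: "I.cl (path_sum w T d) \<in> I" and TJ: "I.cl (path_sum w T d) \<notin> J"
    using T by (auto simp: discrepancy_def)
  have w: "w \<in> verts G" using Tw(2)[OF Nil] by auto
  define S where "S = (\<Union>t\<in>T. set t)"
  have inj: "inj_on (tail G) S"
    unfolding S_def by (rule discrepancy_tails_inj[OF T cardT Nil])
  have "T \<noteq> {[]}"
    using scaled_vertex_in_J[OF w, of "d []"] TI TJ by (auto simp: path_sum_def)
  then obtain t where "t \<in> T" "t \<noteq> []" using Nil by blast
  then have "I.awalk w t w \<and> t \<noteq> [] \<and> set t \<subseteq> S" using Tw(2) by (auto simp: S_def)
  then obtain p where p: "I.awalk w p w" "p \<noteq> []" "set p \<subseteq> S"
    and short: "\<And>q. I.awalk w q w \<Longrightarrow> q \<noteq> [] \<Longrightarrow> set q \<subseteq> S \<Longrightarrow> length p \<le> length q"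
    using ex_has_least_nat[of "\<lambda>q. I.awalk w q w \<and> q \<noteq> [] \<and> set q \<subseteq> S" t length] by metis
  have "distinct (map (tail G) p)"
    by (rule I.closed_walk_distinct_tails[OF p(1,2)]) (use short p(3) in blast)
  then have "cycle_based_at G w p"
    using p by (simp add: cycle_based_at_def)
  then have g: "cycle_element G w (prod_list (map edge p) :: ('v, 'e, 'k) free_alg)"
    unfolding cycle_element_def by blast
  have "\<exists>m. t = concat (replicate m p)" if "t \<in> T" for t
    by (rule I.closed_walk_power[OF inj p(1,3) short p(2) Tw(2)[OF that]])
       (use that in \<open>auto simp: S_def\<close>)
  then have "\<forall>t\<in>T. \<exists>m. t = concat (replicate m p)" by blast
  from I.path_sum_cycle[where c = d, OF Tw(1) Nil d0 p(1,2) this] obtain m a where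
    a: "I.cl (path_sum w T d) = I.cl (free_scale (d [])
      (vtx w + (\<Sum>k=1..m. free_scale (a k :: 'k) (prod_list (map edge p) ^ k))))" (is "_ = I.cl (free_scale _ ?x)")
    by blast
  have "I.cl (free_scale (inverse (d [])) (free_scale (d []) ?x)) \<in> I"
    using I.scale[of "free_scale (d []) ?x" "inverse (d [])"] TI a by simp
  moreover have "free_scale (inverse (d [])) (free_scale (d []) ?x) = ?x"
    using d0 by (simp add: free_scale_conv_mult single_Nil_one flip: mult.assoc)
  ultimately have "I.cl ?x \<in> J" using generators[OF w g] by simp
  then show False using J.scale[of ?x "d []"] TJ a by simp
qed

end

lemma subset: "I \<subseteq> J"
proof (rule subsetI, rule ccontr)
  fix X assume X: "X \<in> I" "X \<notin> J"
  then obtain x where "X = I.cl x"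
    using I.ideal by (auto simp: two_sided_ideal_def leavitt_path_algebra_def)
  then have "\<exists>n u v A c. discrepancy u v A c \<and> card A = n"
    using discrepancy_exists X by blast
  then obtain n where "\<exists>u v A c. discrepancy u v A c \<and> card A = n"
    and "\<And>m. m < n \<Longrightarrow> \<not> (\<exists>u v A c. discrepancy u v A c \<and> card A = m)"
    using exists_least_iff[of "\<lambda>n. \<exists>u v A c. discrepancy u v A c \<and> card A = n"] by blast
  then show False
    using no_minimal_discrepancy[of n] by (metis not_le)
qed

end

theorem theorem8:
  fixes E :: "('v, 'e) pre_digraph"
    and I :: "('v, 'e, 'k::field) free_alg set set"
  assumes "wf_digraph E"
    and "row_finite E"
    and "two_sided_ideal (leavitt_path_algebra E :: ('k, _) nu_algebra) I"
  shows "\<exists>X. X \<subseteq> {lpa_class E (vtx v + (\<Sum>k=1..m. free_scale (c k) (g ^ k))) | v g m (c :: nat \<Rightarrow> 'k).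
                   v \<in> verts E \<and> cycle_element E v g} \<and>
             I = ideal_generated (leavitt_path_algebra E :: ('k, _) nu_algebra) X"
proof -
  let ?A = "leavitt_path_algebra E :: ('k, _) nu_algebra"
  let ?S = "{lpa_class E (vtx v + (\<Sum>k=1..m. free_scale (c k) (g ^ k))) | v g m (c :: nat \<Rightarrow> 'k).
                   v \<in> verts E \<and> cycle_element E v g}"
  have "I \<subseteq> J" if J: "two_sided_ideal ?A J" "?S \<inter> I \<subseteq> J" for J
  proof -
    interpret wf_digraph E by (rule assms)
    interpret lpa_ideal_comparison E I J
      using assms J by unfold_locales blast+
    show ?thesis by (rule subset)
  qed
  then have "I \<subseteq> ideal_generated ?A (?S \<inter> I)"
    unfolding ideal_generated_def by blast
  moreover have "ideal_generated ?A (?S \<inter> I) \<subseteq> I"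
    unfolding ideal_generated_def using assms(3) by blast
  ultimately show ?thesis
    by (intro exI[of _ "?S \<inter> I"]) auto
qed

end
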